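(* For every integer $k \geq 2$ there exists a connected outerplanar graph $G_k$ with exactly $23k+1$ vertices such that $z(G_k) \geq k$, i.e. for every placement of at most $k-1$ zombies on $G_k$ the survivor has a strategy to avoid capture forever.
   Context: All graphs are finite, simple and undirected. The (deterministic) zombies-and-survivor game on a connected graph $G$: in round $0$ the zombies choose starting vertices (several zombies may share a vertex), then the survivor chooses a starting vertex. In each subsequent round, first every zombie must move from its current vertex $u$ to a neighbour $w$ of $u$ that lies on a shortest path in $G$ from $u$ to the survivor's current vertex (if several such $w$ exist, the zombies choose); then the survivor either stays put or moves to an adjacent vertex. Both sides have full information. The zombies win if at some moment a zombie occupies the survivor's vertex; the survivor wins if this never happens. The zombie number $z(G)$ is the minimum number of zombies for which the zombies (choosing their starting positions) have a winning strategy. *)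

theory Defs
  imports "HOL-Analysis.Analysis" "Graph_Theory.Graph_Theory"
begin

text \<open>
  Finite simple undirected graphs are rendered as \<^const>\<open>pair_graph\<close>: finite, loop-free,
  symmetric, and without parallel arcs by construction.
\<close>

definition edges :: "'a pair_pre_digraph \<Rightarrow> 'a set set" where
  "edges G = {{u, v} |u v. (u, v) \<in> parcs G}"

text \<open>
  A planar drawing puts the vertices at distinct points \<open>p v\<close> and draws each edge \<open>e\<close> as a simple
  arc \<open>\<gamma> e\<close> joining its two ends; arcs meet vertices and one another only at common ends.
\<close>

definition planar_drawing ::
  "'a pair_pre_digraph \<Rightarrow> ('a \<Rightarrow> complex) \<Rightarrow> ('a set \<Rightarrow> real \<Rightarrow> complex) \<Rightarrow> bool" where
  "planar_drawing G p \<gamma> \<longleftrightarrow>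
     inj_on p (pverts G) \<and>
     (\<forall>e\<in>edges G. arc (\<gamma> e) \<and> {pathstart (\<gamma> e), pathfinish (\<gamma> e)} = p ` e
        \<and> path_image (\<gamma> e) \<inter> p ` pverts G = p ` e) \<and>
     (\<forall>e\<in>edges G. \<forall>e'\<in>edges G. e \<noteq> e' \<longrightarrow>
        path_image (\<gamma> e) \<inter> path_image (\<gamma> e') = p ` (e \<inter> e'))"

definition drawing_image ::
  "'a pair_pre_digraph \<Rightarrow> ('a \<Rightarrow> complex) \<Rightarrow> ('a set \<Rightarrow> real \<Rightarrow> complex) \<Rightarrow> complex set" where
  "drawing_image G p \<gamma> = p ` pverts G \<union> (\<Union>e\<in>edges G. path_image (\<gamma> e))"

text \<open>
  For a finite graph the drawing is compact, so \<^const>\<open>outside\<close> of it is the single unbounded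
  component of its complement, i.e. the outer face.
\<close>

definition outerplanar :: "'a pair_pre_digraph \<Rightarrow> bool" where
  "outerplanar G \<longleftrightarrow>
     (\<exists>p \<gamma>. planar_drawing G p \<gamma> \<and> p ` pverts G \<subseteq> frontier (outside (drawing_image G p \<gamma>)))"

definition shortest_path ::
  "'a pair_pre_digraph \<Rightarrow> 'a \<Rightarrow> ('a \<times> 'a) list \<Rightarrow> 'a \<Rightarrow> bool" where
  "shortest_path G u es v \<longleftrightarrow>
     pre_digraph.apath (with_proj G) u es v \<and>
     (\<forall>fs. pre_digraph.apath (with_proj G) u fs v \<longrightarrow> length es \<le> length fs)"

definition zombie_move :: "'a pair_pre_digraph \<Rightarrow> 'a \<Rightarrow> 'a \<Rightarrow> 'a \<Rightarrow> bool" where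
  "zombie_move G s u w \<longleftrightarrow>
     (u, w) \<in> parcs G \<and> (\<exists>es. shortest_path G u es s \<and> w \<in> set (pawalk_verts u es))"

definition survivor_move :: "'a pair_pre_digraph \<Rightarrow> 'a \<Rightarrow> 'a \<Rightarrow> bool" where
  "survivor_move G s t \<longleftrightarrow> t = s \<or> (s, t) \<in> parcs G"

definition placement :: "'a pair_pre_digraph \<Rightarrow> nat \<Rightarrow> 'a list \<Rightarrow> bool" where
  "placement G m zs \<longleftrightarrow> length zs = m \<and> set zs \<subseteq> pverts G"

text \<open>
  A play is a pair of sequences: \<open>Z n\<close> lists the positions of the zombies and \<open>S n\<close> is the position
  of the survivor at the end of round \<open>n\<close>. In every round, round 0 included, the zombies act first.
  Capture in round \<open>n\<close> happens either when the zombies have moved (the survivor is then still at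
  \<open>S (n - 1)\<close>) or when the survivor has moved. Play stops at a capture; what the sequences
  contain afterwards is irrelevant, so the rule for the zombies is imposed only before it.
\<close>

definition captured :: "(nat \<Rightarrow> 'a list) \<Rightarrow> (nat \<Rightarrow> 'a) \<Rightarrow> nat \<Rightarrow> bool" where
  "captured Z S n \<longleftrightarrow> (0 < n \<and> S (n - 1) \<in> set (Z n)) \<or> S n \<in> set (Z n)"

definition zombies_legal ::
  "'a pair_pre_digraph \<Rightarrow> (nat \<Rightarrow> 'a list) \<Rightarrow> (nat \<Rightarrow> 'a) \<Rightarrow> nat \<Rightarrow> bool" where
  "zombies_legal G Z S n \<longleftrightarrow>
     ((\<forall>i\<le>n. \<not> captured Z S i) \<longrightarrow> list_all2 (zombie_move G (S n)) (Z n) (Z (Suc n)))"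

definition survivor_legal :: "'a pair_pre_digraph \<Rightarrow> (nat \<Rightarrow> 'a) \<Rightarrow> nat \<Rightarrow> bool" where
  "survivor_legal G S n \<longleftrightarrow>
     (if n = 0 then S 0 \<in> pverts G else survivor_move G (S (n - 1)) (S n))"

text \<open>
  A strategy maps the opponents' past positions to one's own next position(s); one's own past
  is determined by these and the strategy itself. A strategy \<open>\<sigma>\<close> for the zombies receives
  \<open>S 0, \<dots>, S (n - 1)\<close> in round \<open>n\<close> (so \<open>\<sigma> []\<close> is the starting placement), a strategy \<open>\<tau>\<close> for
  the survivor receives \<open>Z 0, \<dots>, Z n\<close>.
\<close>

definition zombie_play :: "('a list \<Rightarrow> 'a list) \<Rightarrow> (nat \<Rightarrow> 'a) \<Rightarrow> nat \<Rightarrow> 'a list" where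
  "zombie_play \<sigma> S n = \<sigma> (map S [0..<n])"

definition survivor_play :: "('a list list \<Rightarrow> 'a) \<Rightarrow> (nat \<Rightarrow> 'a list) \<Rightarrow> nat \<Rightarrow> 'a" where
  "survivor_play \<tau> Z n = \<tau> (map Z [0..<Suc n])"

definition zombies_win :: "'a pair_pre_digraph \<Rightarrow> nat \<Rightarrow> bool" where
  "zombies_win G m \<longleftrightarrow>
     (\<exists>\<sigma>. placement G m (\<sigma> []) \<and>
        (\<forall>S. (\<forall>n. survivor_legal G S n) \<longrightarrow>
           (\<forall>n. zombies_legal G (zombie_play \<sigma> S) S n) \<and>
           (\<exists>n. captured (zombie_play \<sigma> S) S n)))"

text \<open>
  The survivor must play legally and stay uncaptured in every round \<open>N\<close> that is reached by legal
  moves of the zombies.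
\<close>

definition survivor_wins_from :: "'a pair_pre_digraph \<Rightarrow> 'a list \<Rightarrow> bool" where
  "survivor_wins_from G zs \<longleftrightarrow>
     (\<exists>\<tau>. \<forall>Z N. Z 0 = zs \<longrightarrow> (\<forall>n<N. zombies_legal G Z (survivor_play \<tau> Z) n) \<longrightarrow>
        survivor_legal G (survivor_play \<tau> Z) N \<and> \<not> captured Z (survivor_play \<tau> Z) N)"

definition zombie_number :: "'a pair_pre_digraph \<Rightarrow> nat" where
  "zombie_number G = (LEAST m. zombies_win G m)"

text \<open>The minimum is attained: a zombie on every vertex captures at once.\<close>

lemma zombies_win_card:
  assumes "pair_graph G"
  shows "zombies_win G (card (pverts G))"
proof -
  interpret pair_graph G by fact
  obtain zs where zs: "set zs = pverts G" "distinct zs"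
    using pair_finite_verts finite_distinct_list by blast
  then have len: "length zs = card (pverts G)"
    by (metis distinct_card)
  have "captured (zombie_play (\<lambda>_. zs) S) S 0" if "\<forall>n. survivor_legal G S n" for S
    using that[rule_format, of 0] zs by (simp add: survivor_legal_def captured_def zombie_play_def)
  then show ?thesis
    unfolding zombies_win_def using zs len
    by (intro exI[of _ "\<lambda>_. zs"]) (force simp: placement_def zombies_legal_def)
qed

end

theory Submission
  imports Defs
begin

text \<open>
  The graph consists of \<open>k\<close> copies of a 24-vertex gadget that share one vertex, the hub. With fewer
  than \<open>k\<close> zombies some copy is initially free of zombies outside the hub, and the survivor stays in
  it. Every zombie then heads for the hub, arrives there within the first seven rounds, and afterwards
  moves only inside the survivor's gadget. The survivor runs around a fixed 16-cycle of the gadget,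
  without reacting to the zombies. Tracking the set of all vertices a zombie could possibly occupy
  shows that from round 11 on every zombie follows two to four steps behind the survivor. Neither of
  the two chords then offers a shortcut through which the survivor could be intercepted, so the chase
  goes on forever.

  The graph is outerplanar because its vertices can be placed on a parabola in such a way that the
  edges, drawn as chords, do not cross; everything below the parabola then belongs to the outer face.
\<close>

section \<open>Drawings on a parabola\<close>

text \<open>By strict convexity, two chords between such points can cross only if their ends
  interleave.\<close>

definition parabola :: "nat \<Rightarrow> complex" where
  "parabola a = Complex (real a) ((real a)\<^sup>2)"

text \<open>On the chord \<open>Im z\<close> is affine in \<open>Re z\<close>, so the height above
  the parabola is a quadratic with leading coefficient -1 that vanishes at both ends.\<close>

lemma chord_of_parabola:
  assumes "z \<in> closed_segment (parabola a) (parabola b)" and "a \<le> b"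
  shows "real a \<le> Re z" "Re z \<le> real b"
    and "Im z - (Re z)\<^sup>2 = (Re z - real a) * (real b - Re z)"
proof -
  obtain t where t: "0 \<le> t" "t \<le> 1" "z = (1 - t) *\<^sub>R parabola a + t *\<^sub>R parabola b"
    using assms(1) by (auto simp: in_segment)
  have re: "Re z = real a + t * (real b - real a)"
    and im: "Im z = (1 - t) * (real a)\<^sup>2 + t * (real b)\<^sup>2"
    by (simp_all add: t(3) parabola_def algebra_simps)
  have "0 \<le> t * (real b - real a)" "t * (real b - real a) \<le> 1 * (real b - real a)"
    using t(1,2) assms(2) by (simp, intro mult_right_mono) auto
  then show "real a \<le> Re z" "Re z \<le> real b"
    by (auto simp: re)
  show "Im z - (Re z)\<^sup>2 = (Re z - real a) * (real b - Re z)"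
    unfolding re im by (simp add: power2_eq_square algebra_simps)
qed

text \<open>Strictly inside the inner interval each factor of the outer height is at least the inner
  one, and one is larger, so the outer chord runs strictly above the inner one.\<close>

lemma nested_chords_meet:
  fixes a b c d t :: real
  assumes "a \<le> c" "d \<le> b" "c < d" "c \<le> t" "t \<le> d" "(a, b) \<noteq> (c, d)"
    and eq: "(t - a) * (b - t) = (t - c) * (d - t)"
  shows "t \<in> {a, b} \<inter> {c, d}"
proof (cases "t = c \<or> t = d")
  case True
  then show ?thesis using assms by auto
next
  case False
  have "(t - c) * (d - t) < (t - a) * (b - t)"
  proof (cases "a < c")
    case True
    then show ?thesis using False assms by (intro mult_less_le_imp_less) auto
  next
    case nac: False
    then have "d < b" using assms by auto
    then show ?thesis using False assms by (intro mult_le_less_imp_less) auto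
  qed
  then show ?thesis using eq by simp
qed

text \<open>Intervals that do not interleave are nested or overlap in at most one endpoint.\<close>

lemma noncrossing_chords_meet:
  fixes a b c d t :: real
  assumes "a < b" "c < d" "(a, b) \<noteq> (c, d)" "\<not> (a < c \<and> c < b \<and> b < d)" "\<not> (c < a \<and> a < d \<and> d < b)"
    and "a \<le> t" "t \<le> b" "c \<le> t" "t \<le> d"
    and "(t - a) * (b - t) = (t - c) * (d - t)"
  shows "t \<in> {a, b} \<inter> {c, d}"
proof -
  consider "b \<le> c" | "d \<le> a" | "a \<le> c" "d \<le> b" | "c \<le> a" "b \<le> d"
    using assms(1-5) by linarith
  then show ?thesis
  proof cases
    case 3
    then show ?thesis using nested_chords_meet[of a c d b t] assms by auto
  next
    case 4
    then show ?thesis using nested_chords_meet[of c a b d t] assms by auto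
  qed (use assms in auto)
qed

text \<open>The open ray going down from below the parabola is convex, misses \<open>S\<close> and
  is unbounded, so it lies in an unbounded component.\<close>

lemma vertical_ray_subset_outside:
  assumes "\<And>z. z \<in> S \<Longrightarrow> (Re z)\<^sup>2 \<le> Im z" and "y < x\<^sup>2"
  shows "Complex x y \<in> outside S"
proof -
  define T where "T = {z. Re z = x \<and> Im z < x\<^sup>2}"
  have "convex T"
    unfolding T_def
    by (intro convexI) (auto simp: algebra_simps intro: convex_bound_lt simp flip: distrib_right)
  moreover have sub: "T \<subseteq> - S" and mem: "Complex x y \<in> T"
    using assms by (force simp: T_def)+
  ultimately have comp: "T \<subseteq> connected_component_set (- S) (Complex x y)"
    by (intro connected_component_maximal convex_connected)
  have "\<not> bounded T"
  proof
    assume "bounded T"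
    then obtain B where B: "\<And>z. z \<in> T \<Longrightarrow> norm z \<le> B"
      by (auto simp: bounded_iff)
    have "- (\<bar>B\<bar> + 1) < x\<^sup>2"
      by (smt (verit) zero_le_power2)
    then have "Complex x (- (\<bar>B\<bar> + 1)) \<in> T"
      by (auto simp: T_def)
    then have "norm (Complex x (- (\<bar>B\<bar> + 1))) \<le> B"
      by (rule B)
    then show False
      using abs_Im_le_cmod[of "Complex x (- (\<bar>B\<bar> + 1))"] by simp
  qed
  then show ?thesis
    using comp sub mem bounded_subset by (auto simp: outside_def)
qed

text \<open>Vertex \<open>v\<close> is drawn at \<open>parabola v\<close>. It is a limit of points
  straight below it, all of which lie in the outer face.\<close>

lemma noncrossing_imp_outerplanar:
  fixes G :: "nat pair_pre_digraph"
  assumes "pair_graph G"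
    and noncrossing: "\<And>a b c d. \<lbrakk>(a, b) \<in> parcs G; (c, d) \<in> parcs G\<rbrakk> \<Longrightarrow> \<not> (a < c \<and> c < b \<and> b < d)"
  shows "outerplanar G"
proof -
  interpret pair_graph G by fact
  \<comment> \<open>\<open>Min\<close> and \<open>Max\<close> orient the unordered edge from left to
    right, as the chord formula requires.\<close>
  define \<gamma> where "\<gamma> e = linepath (parabola (Min e)) (parabola (Max e))" for e
  have edgeE: "\<exists>a b. e = {a, b} \<and> a < b \<and> (a, b) \<in> parcs G \<and> a \<in> pverts G \<and> b \<in> pverts G
      \<and> \<gamma> e = linepath (parabola a) (parabola b)" if "e \<in> edges G" for e
  proof -
    obtain u v where uv: "e = {u, v}" "(u, v) \<in> parcs G"
      using \<open>e \<in> edges G\<close> by (auto simp: edges_def)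
    then have "(v, u) \<in> parcs G" "u \<noteq> v" "u \<in> pverts G" "v \<in> pverts G"
      using arcs_symmetric by (auto dest: pair_no_loops arc_fst_in_verts arc_snd_in_verts)
    then have mem: "(min u v, max u v) \<in> parcs G" "min u v < max u v" "min u v \<in> pverts G" "max u v \<in> pverts G"
      using uv(2) by (simp_all add: min_def max_def)
    have "e = {min u v, max u v}"
      by (auto simp: uv(1) min_def max_def)
    moreover have "Min e = min u v" "Max e = max u v"
      by (simp_all add: uv(1))
    ultimately show ?thesis
      using mem unfolding \<gamma>_def by metis
  qed
  have inj: "inj_on parabola A" for A
    by (auto simp: inj_on_def parabola_def)
  have on_edge: "Path_Connected.arc (\<gamma> e) \<and> {pathstart (\<gamma> e), pathfinish (\<gamma> e)} = parabola ` e
        \<and> path_image (\<gamma> e) \<inter> parabola ` pverts G = parabola ` e" if e: "e \<in> edges G" for e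
  proof -
    obtain a b where ab: "e = {a, b}" "a < b" "a \<in> pverts G" "b \<in> pverts G"
        "\<gamma> e = linepath (parabola a) (parabola b)"
      using edgeE[OF e] by blast
    have "x \<in> {a, b}" if "parabola x \<in> closed_segment (parabola a) (parabola b)" for x
      using chord_of_parabola(3)[OF that] ab(2) by (auto simp: parabola_def)
    then show ?thesis
      using ab by (auto simp: parabola_def)
  qed
  have two_edges: "path_image (\<gamma> e) \<inter> path_image (\<gamma> e') = parabola ` (e \<inter> e')"
    if e: "e \<in> edges G" and e': "e' \<in> edges G" and ne: "e \<noteq> e'" for e e'
  proof -
    obtain a b where ab: "e = {a, b}" "a < b" "(a, b) \<in> parcs G"
        "\<gamma> e = linepath (parabola a) (parabola b)"
      using edgeE[OF e] by blast
    obtain c d where cd: "e' = {c, d}" "c < d" "(c, d) \<in> parcs G"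
        "\<gamma> e' = linepath (parabola c) (parabola d)"
      using edgeE[OF e'] by blast
    have "z \<in> parabola ` (e \<inter> e')"
      if z: "z \<in> closed_segment (parabola a) (parabola b)" "z \<in> closed_segment (parabola c) (parabola d)"
      for z
    proof -
      note 1 = chord_of_parabola[OF z(1) less_imp_le[OF ab(2)]]
      note 2 = chord_of_parabola[OF z(2) less_imp_le[OF cd(2)]]
      have "Re z \<in> {real a, real b} \<inter> {real c, real d}"
        using 1 2 ab cd ne noncrossing[OF ab(3) cd(3)] noncrossing[OF cd(3) ab(3)]
        by (intro noncrossing_chords_meet) auto
      then obtain x where x: "x \<in> e \<inter> e'" "Re z = real x"
        using ab(1) cd(1) by auto
      \<comment> \<open>At an end of the chord the product in the height formula vanishes, so
        \<open>z\<close> is on the parabola.\<close>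
      then have "Im z = (real x)\<^sup>2"
        using 1(3) 2(3) ab(1) by auto
      with x have "z = parabola x"
        by (simp add: parabola_def complex_eq_iff)
      with x show ?thesis by blast
    qed
    moreover have "parabola x \<in> path_image (\<gamma> e) \<inter> path_image (\<gamma> e')" if "x \<in> e \<inter> e'" for x
      using that ab cd by auto
    ultimately show ?thesis
      using ab(4) cd(4) by auto
  qed
  have drawing: "planar_drawing G parabola \<gamma>"
    unfolding planar_drawing_def
    by (rule conjI[OF inj conjI], rule ballI, erule on_edge, intro ballI impI, rule two_edges)
  have above: "(Re z)\<^sup>2 \<le> Im z" if z: "z \<in> drawing_image G parabola \<gamma>" for z
  proof -
    consider x where "z = parabola x" | e where "e \<in> edges G" "z \<in> path_image (\<gamma> e)"
      using z unfolding drawing_image_def by blast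
    then show ?thesis
    proof cases
      case 2
      obtain a b where ab: "a < b" "\<gamma> e = linepath (parabola a) (parabola b)"
        using edgeE[OF 2(1)] by blast
      then have z: "z \<in> closed_segment (parabola a) (parabola b)"
        using 2(2) by simp
      note 1 = chord_of_parabola[OF z less_imp_le[OF ab(1)]]
      have "0 \<le> (Re z - real a) * (real b - Re z)"
        using 1(1,2) by simp
      then show ?thesis using 1(3) by linarith
    qed (simp add: parabola_def)
  qed
  have "parabola x \<in> frontier (outside (drawing_image G parabola \<gamma>))" if x: "x \<in> pverts G" for x
  proof -
    let ?D = "drawing_image G parabola \<gamma>"
    have "parabola x \<in> closure (outside ?D)"
      unfolding closure_approachable
    proof (intro allI impI)
      fix r :: real
      assume r: "0 < r"
      have "Complex (real x) ((real x)\<^sup>2 - r / 2) \<in> outside ?D"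
        using r by (intro vertical_ray_subset_outside above) auto
      moreover have "dist (Complex (real x) ((real x)\<^sup>2 - r / 2)) (parabola x) < r"
        using r by (simp add: parabola_def dist_norm cmod_def)
      ultimately show "\<exists>y\<in>outside ?D. dist y (parabola x) < r" by blast
    qed
    moreover have "parabola x \<notin> interior (outside ?D)"
    proof -
      have "parabola x \<in> ?D" using x by (simp add: drawing_image_def)
      then show ?thesis using outside_no_overlap[of ?D] interior_subset by blast
    qed
    ultimately show ?thesis by (simp add: frontier_def)
  qed
  with drawing show ?thesis
    unfolding outerplanar_def by blast
qed

section \<open>Shortest paths and evasive walks\<close>

text \<open>
  A function that vanishes at \<open>s\<close>, changes by at most one along arcs and can always be decreased by
  one away from \<open>s\<close> is the distance to \<open>s\<close>; hence a zombie's move decreases it.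
\<close>

lemma awalk_verts_potential_less:
  fixes d :: "'a \<Rightarrow> nat"
  assumes lip: "\<And>x y. (x, y) \<in> parcs G \<Longrightarrow> d x \<le> Suc (d y)" and "d s = 0"
    and "pcas u es s" "set es \<subseteq> parcs G" "x \<in> set (pawalk_verts u es)"
    and "x \<noteq> u"
  shows "d x < length es"
proof -
  \<comment> \<open>For the induction the bound is weak at the start \<open>u\<close>; any other
    vertex lies on the tail of the walk, which is one arc shorter.\<close>
  have "d x \<le> length es \<and> (x \<noteq> u \<longrightarrow> d x < length es)"
    using assms(3-5)
  proof (induction es arbitrary: u x)
    case Nil
    then show ?case using assms(2) by auto
  next
    case (Cons e es)
    have hd: "snd e \<in> set (pawalk_verts (snd e) es)"
      using Cons.prems(1) by (cases es) auto
    then have "d (snd e) \<le> length es"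
      using Cons.IH[of "snd e" "snd e"] Cons.prems by auto
    moreover have "d u \<le> Suc (d (snd e))"
      using Cons.prems by (intro lip) auto
    ultimately have "d u \<le> length (e # es)" by simp
    then show ?case
      using Cons.IH[of "snd e" x] Cons.prems by (auto simp: le_Suc_eq)
  qed
  then show ?thesis using \<open>x \<noteq> u\<close> by auto
qed

text \<open>Greedy descent. The bound on all visited vertices shows that the path from the lower
  neighbour avoids \<open>u\<close>, so prepending \<open>u\<close> repeats no vertex.\<close>

lemma (in pair_wf_digraph) apath_along_potential:
  fixes d :: "'a \<Rightarrow> nat"
  assumes "s \<in> pverts G"
    and desc: "\<And>x. x \<in> pverts G \<Longrightarrow> x \<noteq> s \<Longrightarrow> \<exists>y. (x, y) \<in> parcs G \<and> Suc (d y) = d x"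
    and "u \<in> pverts G"
  shows "\<exists>es. apath u es s \<and> length es \<le> d u \<and> (\<forall>x\<in>set (pawalk_verts u es). d x \<le> d u)"
  using assms(3)
proof (induction "d u" arbitrary: u rule: less_induct)
  case less
  show ?case
  proof (cases "u = s")
    case True
    then show ?thesis
      using assms(1) by (intro exI[of _ "[]"]) (simp add: apath_Nil_iff)
  next
    case False
    then obtain y where y: "(u, y) \<in> parcs G" "Suc (d y) = d u"
      using desc less.prems by blast
    then have "d y < d u" "y \<in> pverts G"
      by (auto dest: in_arcsD2)
    then obtain es where es: "apath y es s" "length es \<le> d y" "\<forall>x\<in>set (pawalk_verts y es). d x \<le> d y"
      using less.hyps by blast
    then have "apath u ((u, y) # es) s"
      using y by (auto simp: apath_Cons_iff)
    then show ?thesis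
      using es y(2) by (intro exI[of _ "(u, y) # es"]) auto
  qed
qed

text \<open>Greedy descent bounds the length of a shortest path by \<open>d u\<close>, and every
  vertex other than \<open>u\<close> on it has potential below that length.\<close>

lemma zombie_move_decreases_potential:
  fixes d :: "'a \<Rightarrow> nat"
  assumes "pair_graph G" "s \<in> pverts G" "d s = 0"
    and lip: "\<And>x y. (x, y) \<in> parcs G \<Longrightarrow> d x \<le> Suc (d y)"
    and desc: "\<And>x. x \<in> pverts G \<Longrightarrow> x \<noteq> s \<Longrightarrow> \<exists>y. (x, y) \<in> parcs G \<and> Suc (d y) = d x"
    and "zombie_move G s u w"
  shows "(u, w) \<in> parcs G" "d w < d u"
proof -
  interpret pair_graph G by fact
  obtain es where uw: "(u, w) \<in> parcs G" and es: "shortest_path G u es s" "w \<in> set (pawalk_verts u es)"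
    using assms(6) by (auto simp: zombie_move_def)
  show "(u, w) \<in> parcs G" by (rule uw)
  have "w \<noteq> u" "u \<in> pverts G"
    using uw by (auto dest: pair_no_loops in_arcsD1)
  then obtain fs where "apath u fs s" "length fs \<le> d u"
    using apath_along_potential[OF assms(2) desc] by blast
  then have "length es \<le> d u"
    using es(1) by (auto simp: shortest_path_def)
  moreover have "pcas u es s" "set es \<subseteq> parcs G"
    using es(1) by (auto simp: shortest_path_def apath_def awalk_def)
  then have "d w < length es"
    using es(2) \<open>w \<noteq> u\<close>
    by (intro awalk_verts_potential_less[where G = G and d = d and s = s, OF lip \<open>d s = 0\<close>])
  ultimately show "d w < d u" by simp
qed

lemma connected_if_potential:
  fixes d :: "'a \<Rightarrow> nat"
  assumes "pair_graph G" "s \<in> pverts G"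
    and desc: "\<And>x. x \<in> pverts G \<Longrightarrow> x \<noteq> s \<Longrightarrow> \<exists>y. (x, y) \<in> parcs G \<and> Suc (d y) = d x"
  shows "Digraph_Component.connected (with_proj G)"
proof -
  interpret pair_graph G by fact
  have to_s: "u \<rightarrow>\<^sup>*\<^bsub>G\<^esub> s" if "u \<in> pverts G" for u
    using apath_along_potential[OF assms(2) desc that] reachable_apath by blast
  then have "u \<rightarrow>\<^sup>*\<^bsub>G\<^esub> v" if "u \<in> pverts G" "v \<in> pverts G" for u v
    using that symmetric_reachable[OF pair_sym_arcs] reachable_trans by blast
  then show ?thesis
    using assms(2) by (intro connectedI reachable_mk_symmetricI) auto
qed

text \<open>\<open>I n\<close> overestimates the vertices that zombies can occupy in round
  \<open>n\<close>. The two avoidance hypotheses match the two moments of capture: after the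
  survivor's move and after the next move of the zombies.\<close>

lemma evasive_walk_uncaptured:
  assumes "set (Z 0) \<subseteq> I 0"
    and step: "\<And>n u w. u \<in> I n \<Longrightarrow> zombie_move G (S n) u w \<Longrightarrow> w \<in> I (Suc n)"
    and avoid: "\<And>n. S n \<notin> I n" "\<And>n. S n \<notin> I (Suc n)"
    and legal: "\<And>n. n < N \<Longrightarrow> zombies_legal G Z S n"
  shows "\<not> captured Z S N"
proof -
  \<comment> \<open>Absence of earlier captures is part of the invariant because the zombies are
    bound by their rule only until a capture.\<close>
  have "set (Z n) \<subseteq> I n \<and> (\<forall>i\<le>n. \<not> captured Z S i)" if "n \<le> N" for n
    using that
  proof (induction n)
    case 0
    then show ?case using assms(1) avoid(1)[of 0] by (auto simp: captured_def)
  next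
    case (Suc n)
    then have "list_all2 (zombie_move G (S n)) (Z n) (Z (Suc n))"
      using legal[of n] by (simp add: zombies_legal_def)
    then have "set (Z (Suc n)) \<subseteq> I (Suc n)"
      using Suc.IH Suc.prems step[of _ n] unfolding list_all2_conv_all_nth
      by (metis Suc_leD in_set_conv_nth subset_code(1))
    moreover from this have "\<not> captured Z S (Suc n)"
      using avoid(1)[of "Suc n"] avoid(2)[of n] by (auto simp: captured_def)
    ultimately show ?case using Suc by (auto simp: le_Suc_eq)
  qed
  then show ?thesis by blast
qed

lemma survivor_wins_by_evasive_walk:
  assumes "set zs \<subseteq> I 0"
    and "\<And>n u w. u \<in> I n \<Longrightarrow> zombie_move G (S n) u w \<Longrightarrow> w \<in> I (Suc n)"
    and "\<And>n. S n \<notin> I n" "\<And>n. S n \<notin> I (Suc n)"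
    and legal: "\<And>n. survivor_legal G S n"
  shows "survivor_wins_from G zs"
    and "\<sigma> [] = zs \<Longrightarrow> (\<And>n. zombies_legal G (zombie_play \<sigma> S) S n) \<Longrightarrow> \<not> captured (zombie_play \<sigma> S) S n"
proof -
  \<comment> \<open>The strategy reads only the length of the history, which is \<open>n + 1\<close>
    in round \<open>n\<close>.\<close>
  have "survivor_play (\<lambda>Zs. S (length Zs - 1)) Z = S" for Z :: "nat \<Rightarrow> 'a list"
    by (simp add: survivor_play_def fun_eq_iff)
  then show "survivor_wins_from G zs"
    unfolding survivor_wins_from_def
    using evasive_walk_uncaptured[where I = I and G = G and S = S, OF _ assms(2-4)] assms(1) legal
    by (intro exI[of _ "\<lambda>Zs. S (length Zs - 1)"]) auto
  show "\<not> captured (zombie_play \<sigma> S) S n"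
    if "\<sigma> [] = zs" "\<And>n. zombies_legal G (zombie_play \<sigma> S) S n"
    using that assms(1)
    by (intro evasive_walk_uncaptured[where I = I and G = G and S = S, OF _ assms(2-4)])
      (auto simp: zombie_play_def)
qed

section \<open>The gadget\<close>

text \<open>
  The gadget has hub 0 and consists of the cycle through 0, ..., 18, the chords 2--17 and 8--16, and
  leaves 19, ..., 23 at the hub that only pad the number of vertices.
\<close>

definition gadget_edges :: "(nat \<times> nat) list" where
  "gadget_edges =
     [(0, 1), (1, 2), (2, 3), (3, 4), (4, 5), (5, 6), (6, 7), (7, 8), (8, 9), (9, 10), (10, 11),
      (11, 12), (12, 13), (13, 14), (14, 15), (15, 16), (16, 17), (17, 18), (0, 18), (2, 17),
      (8, 16), (0, 19), (0, 20), (0, 21), (0, 22), (0, 23)]"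

definition gadget_arcs :: "(nat \<times> nat) list" where
  "gadget_arcs = gadget_edges @ map prod.swap gadget_edges"

text \<open>Row \<open>s\<close> lists the distances from \<open>s\<close> to 0, ..., 23; no target beyond 17 is ever needed.\<close>

definition gadget_rows :: "nat list list" where
  "gadget_rows = [
   [0, 1, 2, 3, 4, 5, 6, 5, 4, 5, 6, 7, 7, 6, 5, 4, 3, 2, 1, 1, 1, 1, 1, 1],
   [1, 0, 1, 2, 3, 4, 5, 5, 4, 5, 6, 7, 7, 6, 5, 4, 3, 2, 2, 2, 2, 2, 2, 2],
   [2, 1, 0, 1, 2, 3, 4, 4, 3, 4, 5, 6, 6, 5, 4, 3, 2, 1, 2, 3, 3, 3, 3, 3],
   [3, 2, 1, 0, 1, 2, 3, 4, 4, 5, 6, 7, 7, 6, 5, 4, 3, 2, 3, 4, 4, 4, 4, 4],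
   [4, 3, 2, 1, 0, 1, 2, 3, 4, 5, 6, 7, 8, 7, 6, 5, 4, 3, 4, 5, 5, 5, 5, 5],
   [5, 4, 3, 2, 1, 0, 1, 2, 3, 4, 5, 6, 7, 7, 6, 5, 4, 4, 5, 6, 6, 6, 6, 6],
   [6, 5, 4, 3, 2, 1, 0, 1, 2, 3, 4, 5, 6, 6, 5, 4, 3, 4, 5, 7, 7, 7, 7, 7],
   [5, 5, 4, 4, 3, 2, 1, 0, 1, 2, 3, 4, 5, 5, 4, 3, 2, 3, 4, 6, 6, 6, 6, 6],
   [4, 4, 3, 4, 4, 3, 2, 1, 0, 1, 2, 3, 4, 4, 3, 2, 1, 2, 3, 5, 5, 5, 5, 5],
   [5, 5, 4, 5, 5, 4, 3, 2, 1, 0, 1, 2, 3, 4, 4, 3, 2, 3, 4, 6, 6, 6, 6, 6],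
   [6, 6, 5, 6, 6, 5, 4, 3, 2, 1, 0, 1, 2, 3, 4, 4, 3, 4, 5, 7, 7, 7, 7, 7],
   [7, 7, 6, 7, 7, 6, 5, 4, 3, 2, 1, 0, 1, 2, 3, 4, 4, 5, 6, 8, 8, 8, 8, 8],
   [7, 7, 6, 7, 8, 7, 6, 5, 4, 3, 2, 1, 0, 1, 2, 3, 4, 5, 6, 8, 8, 8, 8, 8],
   [6, 6, 5, 6, 7, 7, 6, 5, 4, 4, 3, 2, 1, 0, 1, 2, 3, 4, 5, 7, 7, 7, 7, 7],
   [5, 5, 4, 5, 6, 6, 5, 4, 3, 4, 4, 3, 2, 1, 0, 1, 2, 3, 4, 6, 6, 6, 6, 6],
   [4, 4, 3, 4, 5, 5, 4, 3, 2, 3, 4, 4, 3, 2, 1, 0, 1, 2, 3, 5, 5, 5, 5, 5],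
   [3, 3, 2, 3, 4, 4, 3, 2, 1, 2, 3, 4, 4, 3, 2, 1, 0, 1, 2, 4, 4, 4, 4, 4],
   [2, 2, 1, 2, 3, 4, 4, 3, 2, 3, 4, 5, 5, 4, 3, 2, 1, 0, 1, 3, 3, 3, 3, 3]]"

text \<open>One rule per row keeps the simplifier from copying the whole table at every lookup.\<close>

lemmas gadget_row_simps = arg_cong[OF gadget_rows_def, of "\<lambda>t. t ! 0", simplified]
  arg_cong[OF gadget_rows_def, of "\<lambda>t. t ! 1", simplified]
  arg_cong[OF gadget_rows_def, of "\<lambda>t. t ! 2", simplified]
  arg_cong[OF gadget_rows_def, of "\<lambda>t. t ! 3", simplified]
  arg_cong[OF gadget_rows_def, of "\<lambda>t. t ! 4", simplified]
  arg_cong[OF gadget_rows_def, of "\<lambda>t. t ! 5", simplified]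
  arg_cong[OF gadget_rows_def, of "\<lambda>t. t ! 6", simplified]
  arg_cong[OF gadget_rows_def, of "\<lambda>t. t ! 7", simplified]
  arg_cong[OF gadget_rows_def, of "\<lambda>t. t ! 8", simplified]
  arg_cong[OF gadget_rows_def, of "\<lambda>t. t ! 9", simplified]
  arg_cong[OF gadget_rows_def, of "\<lambda>t. t ! 10", simplified]
  arg_cong[OF gadget_rows_def, of "\<lambda>t. t ! 11", simplified]
  arg_cong[OF gadget_rows_def, of "\<lambda>t. t ! 12", simplified]
  arg_cong[OF gadget_rows_def, of "\<lambda>t. t ! 13", simplified]
  arg_cong[OF gadget_rows_def, of "\<lambda>t. t ! 14", simplified]
  arg_cong[OF gadget_rows_def, of "\<lambda>t. t ! 15", simplified]
  arg_cong[OF gadget_rows_def, of "\<lambda>t. t ! 16", simplified]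
  arg_cong[OF gadget_rows_def, of "\<lambda>t. t ! 17", simplified]

definition gadget_dist :: "nat \<Rightarrow> nat \<Rightarrow> nat" where
  "gadget_dist s a = gadget_rows ! s ! a"

lemma upt_0_expand:
    "[0..<8] = [0, 1, 2, 3, 4, 5, 6, 7]"
    "[0..<11] = [0, 1, 2, 3, 4, 5, 6, 7, 8, 9, 10]"
    "[0..<16] = [0, 1, 2, 3, 4, 5, 6, 7, 8, 9, 10, 11, 12, 13, 14, 15]"
    "[0..<18] = [0, 1, 2, 3, 4, 5, 6, 7, 8, 9, 10, 11, 12, 13, 14, 15, 16, 17]"
    "[0..<24] = [0, 1, 2, 3, 4, 5, 6, 7, 8, 9, 10, 11, 12,
      13, 14, 15, 16, 17, 18, 19, 20, 21, 22, 23]"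
  by (simp_all add: upt_rec)

lemma gadget_arcs_wf: "list_all (\<lambda>(a, b). a < 24 \<and> b < 24 \<and> a \<noteq> b) gadget_arcs"
  by (simp add: upt_0_expand gadget_arcs_def gadget_edges_def gadget_dist_def gadget_row_simps)

lemma gadget_arcs_sym: "(a, b) \<in> set gadget_arcs \<Longrightarrow> (b, a) \<in> set gadget_arcs"
  by (force simp: gadget_arcs_def)

lemma gadget_arcs_noncrossing:
  "list_all (\<lambda>(a, b). list_all (\<lambda>(c, d). \<not> (a < c \<and> c < b \<and> b < d)) gadget_arcs) gadget_arcs"
  by (simp add: upt_0_expand gadget_arcs_def gadget_edges_def gadget_dist_def gadget_row_simps)

lemma gadget_dist_self: "list_all (\<lambda>s. gadget_dist s s = 0) [0..<18]"
  by (simp add: upt_0_expand gadget_arcs_def gadget_edges_def gadget_dist_def gadget_row_simps)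

lemma gadget_dist_arc:
  "list_all (\<lambda>s. list_all (\<lambda>(a, b). gadget_dist s a \<le> Suc (gadget_dist s b)) gadget_arcs) [0..<18]"
  by (simp add: upt_0_expand gadget_arcs_def gadget_edges_def gadget_dist_def gadget_row_simps)

lemma gadget_dist_descent:
  "list_all (\<lambda>s. list_all (\<lambda>a. a \<noteq> s \<longrightarrow>
     list_ex (\<lambda>(x, b). x = a \<and> Suc (gadget_dist s b) = gadget_dist s a) gadget_arcs) [0..<24]) [0..<18]"
  by (simp add: upt_0_expand gadget_arcs_def gadget_edges_def gadget_dist_def gadget_row_simps)

lemma gadget_depth_le: "list_all (\<lambda>a. gadget_dist 0 a \<le> 7) [0..<24]"
  by (simp add: upt_0_expand gadget_arcs_def gadget_edges_def gadget_dist_def gadget_row_simps)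

text \<open>The survivor runs around the cycle 17, 2, 3, ..., 16, closed by the chord 2--17.\<close>

definition survivor_walk :: "nat \<Rightarrow> nat" where
  "survivor_walk n = (if n mod 16 = 0 then 17 else n mod 16 + 1)"

text \<open>
  The vertices of the survivor's gadget that a zombie starting outside of it can occupy after \<open>n\<close>
  rounds. From round 11 on the zombies trail the survivor by two to four steps; since the walk has
  period 16, these positions are written with \<open>n + 12\<close>, \<open>n + 13\<close>, \<open>n + 14\<close>, avoiding subtraction.
\<close>

definition flood :: "nat \<Rightarrow> nat list" where
  "flood n =
    (if n < 11 then
      [[0], [0, 18], [0, 1, 17], [0, 1, 2], [0, 1, 2, 3], [0, 1, 2, 3, 4], [0, 1, 2, 3, 4, 5, 18],
       [0, 2, 4, 5, 6, 17, 18], [5, 6, 7, 16, 17, 18], [6, 7, 8, 16, 17], [7, 8, 9, 16]] ! n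
     else [survivor_walk (n + 12), survivor_walk (n + 13), survivor_walk (n + 14)])"

text \<open>A certificate for one round: the zombies move from \<open>A\<close> to \<open>B\<close>
  while the survivor stands at \<open>s\<close>. The two non-membership conditions exclude capture
  before and after that move.\<close>

definition floods :: "nat \<Rightarrow> nat list \<Rightarrow> nat list \<Rightarrow> bool" where
  "floods s A B \<longleftrightarrow> s \<notin> set A \<and> s \<notin> set B \<and> (\<forall>a\<in>set A. a < 24) \<and>
     list_all (\<lambda>(a, b). a \<in> set A \<longrightarrow> gadget_dist s b < gadget_dist s a \<longrightarrow> b \<in> set B) gadget_arcs"

text \<open>Checked by evaluation. The last case leads into the trailing triple: with the survivor
  at 11, a zombie at 16 must take the chord to 8.\<close>

lemma floods_early: "list_all (\<lambda>n. floods (survivor_walk n) (flood n) (flood (Suc n))) [0..<11]"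
  by (simp only: upt_0_expand list.pred_inject, simp add: flood_def survivor_walk_def,
      simp add: floods_def gadget_arcs_def gadget_edges_def gadget_dist_def gadget_row_simps flip: numeral_2_eq_2)

text \<open>Modulo 16 the offsets 12, 13, 14 are -4, -3, -2. The zombies' move reduces the gap to
  one to three, and the survivor's next step restores it. One period of residues covers all later
  rounds.\<close>

lemma floods_late:
  "list_all (\<lambda>r. floods (survivor_walk r)
     [survivor_walk (r + 12), survivor_walk (r + 13), survivor_walk (r + 14)]
     [survivor_walk (r + 13), survivor_walk (r + 14), survivor_walk (r + 15)]) [0..<16]"
  by (simp only: upt_0_expand list.pred_inject, simp add: flood_def survivor_walk_def,
      simp add: floods_def gadget_arcs_def gadget_edges_def gadget_dist_def gadget_row_simps flip: numeral_2_eq_2)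

text \<open>No gadget vertex is more than 7 from the hub, so arrivals from other copies can occur up
  to round 7 and must be covered until then.\<close>

lemma hub_in_flood: "list_all (\<lambda>n. 0 \<in> set (flood n)) [0..<8]"
  by (simp add: upt_0_expand flood_def)

lemma survivor_walk_arc_period:
  "list_all (\<lambda>r. (survivor_walk r, survivor_walk (r + 1)) \<in> set gadget_arcs) [0..<16]"
  by (simp only: upt_0_expand list.pred_inject, simp add: survivor_walk_def gadget_arcs_def gadget_edges_def)

section \<open>Gadgets sharing a hub\<close>

text \<open>Copy \<open>i\<close> fills the block of 23 consecutive numbers after
  \<open>23 * i\<close>, and the hub stays 0. Disjoint consecutive blocks keep the parabola drawing
  free of crossings.\<close>

definition copy :: "nat \<Rightarrow> nat \<Rightarrow> nat" where
  "copy i a = (if a = 0 then 0 else 23 * i + a)"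

definition gadget_star :: "nat \<Rightarrow> nat pair_pre_digraph" where
  "gadget_star k = \<lparr>pverts = {..23 * k},
     parcs = {(copy i a, copy i b) |i a b. i < k \<and> (a, b) \<in> set gadget_arcs}\<rparr>"

lemma gadget_arcsD:
  assumes "(a, b) \<in> set gadget_arcs"
  shows "a < 24" "b < 24" "a \<noteq> b"
  using gadget_arcs_wf assms by (auto simp: list_all_iff)

lemma copy_index:
  assumes "0 < a" "a < 24"
  shows "0 < copy i a" "(copy i a - 1) div 23 = i" "(copy i a - 1) mod 23 + 1 = a"
proof -
  obtain c where "a = Suc c" "c < 23"
    using assms by (cases a) auto
  then show "0 < copy i a" "(copy i a - 1) div 23 = i" "(copy i a - 1) mod 23 + 1 = a"
    by (simp_all add: copy_def)
qed

lemma copy_eq_iff: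
  assumes "a < 24" "b < 24"
  shows "copy i a = copy j b \<longleftrightarrow> a = b \<and> (a = 0 \<or> i = j)"
proof (cases "a = 0 \<or> b = 0")
  case True
  then show ?thesis by (auto simp: copy_def)
next
  case False
  then show ?thesis
    using copy_index[of a i] copy_index[of b j] assms by fastforce
qed

lemma copy_le: "i < k \<Longrightarrow> a < 24 \<Longrightarrow> copy i a \<le> 23 * k"
  by (auto simp: copy_def)

lemma copy_cases:
  assumes "v \<le> 23 * k" "0 < k"
  obtains i a where "i < k" "a < 24" "v = copy i a" "0 < v \<Longrightarrow> 0 < a"
proof (cases v)
  case 0
  then show ?thesis using that[of 0 0] assms by (simp add: copy_def)
next
  case (Suc x)
  have "x div 23 < k"
    using Suc assms(1) by (intro less_mult_imp_div_less) simp
  moreover have "v = copy (x div 23) (Suc (x mod 23))"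
    by (simp add: Suc copy_def)
  moreover have "x mod 23 < 23" by simp
  then have "Suc (x mod 23) < 24" by linarith
  ultimately show ?thesis
    using that by blast
qed

lemma pair_graph_gadget_star: "pair_graph (gadget_star k)"
proof
  fix e assume e: "e \<in> parcs (gadget_star k)"
  then obtain i a b where "e = (copy i a, copy i b)" "i < k" "(a, b) \<in> set gadget_arcs"
    by (auto simp: gadget_star_def)
  then show "fst e \<in> pverts (gadget_star k)" "snd e \<in> pverts (gadget_star k)" "fst e \<noteq> snd e"
    using gadget_arcsD[of a b] copy_le[of i k] by (auto simp: gadget_star_def copy_eq_iff)
next
  show "finite (pverts (gadget_star k))"
    by (simp add: gadget_star_def)
  have "parcs (gadget_star k) \<subseteq> (\<lambda>(i, a, b). (copy i a, copy i b)) ` ({..<k} \<times> set gadget_arcs)"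
    by (force simp: gadget_star_def)
  then show "finite (parcs (gadget_star k))"
    by (rule finite_subset) auto
  show "symmetric (with_proj (gadget_star k))"
    by (auto simp: symmetric_def gadget_star_def intro!: symI dest: gadget_arcs_sym)
qed

text \<open>Within one copy \<open>copy i\<close> preserves the order, so the check on the gadget
  applies. For two copies, \<open>u'\<close> and \<open>v'\<close> would be positive and in one
  block, with \<open>v\<close> from another block between them.\<close>

lemma gadget_star_noncrossing:
  assumes "(u, v) \<in> parcs (gadget_star k)" "(u', v') \<in> parcs (gadget_star k)"
  shows "\<not> (u < u' \<and> u' < v \<and> v < v')"
proof
  assume less: "u < u' \<and> u' < v \<and> v < v'"
  obtain i a b where 1: "u = copy i a" "v = copy i b" "(a, b) \<in> set gadget_arcs"
    using assms(1) by (auto simp: gadget_star_def)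
  obtain j c d where 2: "u' = copy j c" "v' = copy j d" "(c, d) \<in> set gadget_arcs"
    using assms(2) by (auto simp: gadget_star_def)
  have bounds: "a < 24" "b < 24" "c < 24" "d < 24"
    using gadget_arcsD 1(3) 2(3) by auto
  consider "i = j" | "i < j" | "j < i" by linarith
  then show False
  proof cases
    case 1
    then have "a < c" "c < b" "b < d"
      using less \<open>u = _\<close> \<open>v = _\<close> 2(1,2) by (auto simp: copy_def split: if_splits)
    then show False
      using gadget_arcs_noncrossing \<open>(a, b) \<in> _\<close> 2(3) by (fastforce simp: list_all_iff)
  qed (use less 1(1,2) 2(1,2) bounds in \<open>auto simp: copy_def split: if_splits\<close>)
qed

text \<open>The distance of \<open>v\<close> from \<open>copy i s\<close>: a path from another gadget passes through the hub.\<close>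

definition star_dist :: "nat \<Rightarrow> nat \<Rightarrow> nat \<Rightarrow> nat" where
  "star_dist i s v =
    (if v = 0 then gadget_dist s 0
     else if (v - 1) div 23 = i then gadget_dist s ((v - 1) mod 23 + 1)
     else gadget_dist 0 ((v - 1) mod 23 + 1) + gadget_dist s 0)"

lemma gadget_dist_facts:
  assumes "s < 18"
  shows "gadget_dist s s = 0"
    and "(a, b) \<in> set gadget_arcs \<Longrightarrow> gadget_dist s a \<le> Suc (gadget_dist s b)"
    and "a < 24 \<Longrightarrow> a \<noteq> s \<Longrightarrow> \<exists>b. (a, b) \<in> set gadget_arcs \<and> Suc (gadget_dist s b) = gadget_dist s a"
proof -
  have s: "s \<in> set [0..<18]"
    using assms by simp
  then show "gadget_dist s s = 0"
    using gadget_dist_self unfolding list_all_iff by blast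
  show "gadget_dist s a \<le> Suc (gadget_dist s b)" if "(a, b) \<in> set gadget_arcs"
    using gadget_dist_arc s that unfolding list_all_iff by blast
  show "\<exists>b. (a, b) \<in> set gadget_arcs \<and> Suc (gadget_dist s b) = gadget_dist s a" if "a < 24" "a \<noteq> s"
  proof -
    have "a \<in> set [0..<24]"
      using that by simp
    then show ?thesis
      using gadget_dist_descent s that(2) unfolding list_all_iff list_ex_iff by blast
  qed
qed

lemma star_dist_copy:
  assumes "a < 24"
  shows "star_dist i s (copy i a) = gadget_dist s a"
    and "j \<noteq> i \<Longrightarrow> star_dist i s (copy j a) = gadget_dist 0 a + gadget_dist s 0"
proof -
  have "star_dist i s (copy i a) = gadget_dist s a \<and>
      (j \<noteq> i \<longrightarrow> star_dist i s (copy j a) = gadget_dist 0 a + gadget_dist s 0)"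
  proof (cases "a = 0")
    case True
    then show ?thesis by (simp add: star_dist_def copy_def gadget_dist_facts(1))
  next
    case False
    then have "0 < a" by simp
    note index = copy_index[OF this assms]
    show ?thesis
      using index(1)[of i] index(1)[of j] unfolding star_dist_def index by simp
  qed
  then show "star_dist i s (copy i a) = gadget_dist s a"
    and "j \<noteq> i \<Longrightarrow> star_dist i s (copy j a) = gadget_dist 0 a + gadget_dist s 0"
    by blast+
qed

lemma star_dist_descent:
  assumes "s < 18" "i < k" "v \<in> pverts (gadget_star k)" "v \<noteq> copy i s"
  shows "\<exists>w. (v, w) \<in> parcs (gadget_star k) \<and> Suc (star_dist i s w) = star_dist i s v"
proof -
  have "v \<le> 23 * k" "0 < k" using assms by (auto simp: gadget_star_def)
  then obtain j' a where "j' < k" and a: "a < 24" "v = copy j' a" by (rule copy_cases)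
  \<comment> \<open>The hub belongs to every copy and is counted in copy \<open>i\<close>, so that
    descent from it enters the target's gadget.\<close>
  define j where "j = (if a = 0 then i else j')"
  have j: "j < k" "v = copy j a" "j \<noteq> i \<Longrightarrow> a \<noteq> 0"
    using a \<open>j' < k\<close> assms(2) by (auto simp: j_def copy_def split: if_splits)
  \<comment> \<open>Other copies descend towards the hub.\<close>
  define t where "t = (if j = i then s else 0)"
  have "a \<noteq> t" "t < 18" using j assms by (auto simp: t_def)
  then obtain b where b: "(a, b) \<in> set gadget_arcs" "Suc (gadget_dist t b) = gadget_dist t a"
    using gadget_dist_facts(3) a(1) by blast
  have "(v, copy j b) \<in> parcs (gadget_star k)"
    using j b by (auto simp: gadget_star_def)
  moreover have "Suc (star_dist i s (copy j b)) = star_dist i s v"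
    using b a(1) gadget_arcsD(2)[OF b(1)] unfolding j(2)
    by (cases "j = i") (auto simp: t_def star_dist_copy)
  ultimately show ?thesis by blast
qed

lemma star_dist_arc:
  assumes "s < 18" "(v, w) \<in> parcs (gadget_star k)"
  shows "star_dist i s v \<le> Suc (star_dist i s w)"
proof -
  obtain j a b where j: "v = copy j a" "w = copy j b" "(a, b) \<in> set gadget_arcs"
    using assms(2) by (auto simp: gadget_star_def)
  then show ?thesis
    using gadget_dist_facts(2)[OF assms(1) j(3)] gadget_dist_facts(2)[of 0, OF _ j(3)] gadget_arcsD[OF j(3)]
    by (cases "j = i") (auto simp: star_dist_copy)
qed

lemma connected_gadget_star: "0 < k \<Longrightarrow> Digraph_Component.connected (with_proj (gadget_star k))"
  using star_dist_descent[of 0 0]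
  by (intro connected_if_potential[OF pair_graph_gadget_star, of 0 _ "star_dist 0 0"])
    (auto simp: copy_def gadget_star_def)

lemma zombie_move_gadget_star:
  assumes "s < 18" "i < k" "a < 24" and mv: "zombie_move (gadget_star k) (copy i s) (copy j a) w"
  shows "j = i \<Longrightarrow> \<exists>b. (a, b) \<in> set gadget_arcs \<and> gadget_dist s b < gadget_dist s a \<and> w = copy i b"
    and "j \<noteq> i \<Longrightarrow> 0 < a \<Longrightarrow> \<exists>b. (a, b) \<in> set gadget_arcs \<and> gadget_dist 0 b < gadget_dist 0 a \<and> w = copy j b"
proof -
  have "star_dist i s (copy i s) = 0" "copy i s \<in> pverts (gadget_star k)"
    using assms gadget_dist_facts(1) copy_le by (auto simp: star_dist_copy gadget_star_def)
  then have arc: "(copy j a, w) \<in> parcs (gadget_star k)"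
    and less: "star_dist i s w < star_dist i s (copy j a)"
    using zombie_move_decreases_potential[OF pair_graph_gadget_star, of "copy i s" k "star_dist i s", OF _ _ _ _ mv]
      star_dist_arc[OF assms(1)] star_dist_descent[OF assms(1,2)] by blast+
  obtain j' a' b where a': "copy j a = copy j' a'" "(a', b) \<in> set gadget_arcs" "w = copy j' b"
    using arc by (auto simp: gadget_star_def)
  then have "a' = a" "a = 0 \<or> j' = j"
    using copy_eq_iff[OF assms(3) gadget_arcsD(1)[OF a'(2)]] by auto
  with a' have b: "(a, b) \<in> set gadget_arcs" "w = copy j' b" "copy j a = copy j' a" "a = 0 \<or> j' = j"
    by auto
  note lt = less[unfolded b(2,3)]
  \<comment> \<open>If \<open>j' \<noteq> i\<close>, the zombie leaves the hub for a foreign copy,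
    where \<open>star_dist\<close> is at least its value \<open>gadget_dist s 0\<close> at the hub,
    contradicting the decrease.\<close>
  show "\<exists>b. (a, b) \<in> set gadget_arcs \<and> gadget_dist s b < gadget_dist s a \<and> w = copy i b" if "j = i"
    using b lt assms(3) gadget_arcsD(2)[OF b(1)] that
    by (cases "j' = i") (auto simp: star_dist_copy gadget_dist_facts(1))
  show "\<exists>b. (a, b) \<in> set gadget_arcs \<and> gadget_dist 0 b < gadget_dist 0 a \<and> w = copy j b"
    if "j \<noteq> i" "0 < a"
  proof -
    have "j' = j" using b(4) that(2) by auto
    with lt have "gadget_dist 0 b < gadget_dist 0 a"
      using star_dist_copy(2)[OF gadget_arcsD(2)[OF b(1)] that(1)] star_dist_copy(2)[OF assms(3) that(1)]
      by simp
    then show ?thesis using b(1,2) \<open>j' = j\<close> by blast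
  qed
qed

section \<open>The survivor's strategy\<close>

lemma survivor_walk_mod: "survivor_walk (n mod 16 + c) = survivor_walk (n + c)"
  by (simp add: survivor_walk_def mod_add_left_eq)

lemma survivor_walk_less: "survivor_walk n < 18"
proof -
  have "n mod 16 + 1 < 18"
    using mod_less_divisor[of 16 n] by linarith
  then show ?thesis
    by (simp only: survivor_walk_def split: if_split) simp
qed

lemma mod_16_cases: "n mod 16 \<in> set [0..<16]" for n :: nat
  by simp

lemma survivor_walk_arc: "(survivor_walk n, survivor_walk (Suc n)) \<in> set gadget_arcs"
  using survivor_walk_arc_period[unfolded list_all_iff, rule_format, OF mod_16_cases[of n]]
    survivor_walk_mod[of n 0] survivor_walk_mod[of n 1] by simp

lemma floods_all: "floods (survivor_walk n) (flood n) (flood (Suc n))"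
proof (cases "n < 11")
  case True
  then have "n \<in> set [0..<11]"
    by simp
  then show ?thesis using floods_early unfolding list_all_iff by blast
next
  case False
  then have "flood n = [survivor_walk (n + 12), survivor_walk (n + 13), survivor_walk (n + 14)]"
    and "flood (Suc n) = [survivor_walk (n + 13), survivor_walk (n + 14), survivor_walk (n + 15)]"
    by (simp_all add: flood_def add.commute)
  then show ?thesis
    using floods_late[unfolded list_all_iff, rule_format, OF mod_16_cases[of n]]
    by (simp only: survivor_walk_mod survivor_walk_mod[of n 0, unfolded add_0_right])
qed

lemma floodsD:
  assumes "floods s A B"
  shows "s \<notin> set A" "s \<notin> set B" "a \<in> set A \<Longrightarrow> a < 24"
    "a \<in> set A \<Longrightarrow> (a, b) \<in> set gadget_arcs \<Longrightarrow> gadget_dist s b < gadget_dist s a \<Longrightarrow> b \<in> set B"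
  using assms by (auto simp: floods_def list_all_iff)

text \<open>
  A zombie outside the survivor's gadget can only walk straight to the hub, from which it is at most
  7 steps away at the start.
\<close>

definition zombie_zone :: "nat \<Rightarrow> nat \<Rightarrow> nat set" where
  "zombie_zone i n = copy i ` set (flood n) \<union>
     {copy j a |j a. j \<noteq> i \<and> 0 < a \<and> a < 24 \<and> gadget_dist 0 a + n \<le> 7}"

lemma zombie_zone_start:
  assumes "v \<le> 23 * k" "0 < k" "v = 0 \<or> (v - 1) div 23 \<noteq> i"
  shows "v \<in> zombie_zone i 0"
proof (cases "v = 0")
  case True
  then have "v = copy i 0" "0 \<in> set (flood 0)"
    by (simp_all add: copy_def flood_def)
  then show ?thesis by (auto simp: zombie_zone_def)
next
  case False
  obtain j a where ja: "j < k" "a < 24" "v = copy j a" "0 < v \<Longrightarrow> 0 < a"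
    using copy_cases[OF assms(1,2)] by metis
  with False assms(3) have "0 < a" "j \<noteq> i"
    using copy_index(2) by auto
  have "a \<in> set [0..<24]"
    using ja(2) by simp
  then have "gadget_dist 0 a \<le> 7"
    using gadget_depth_le unfolding list_all_iff by blast
  then show ?thesis
    using ja(2,3) \<open>0 < a\<close> \<open>j \<noteq> i\<close> unfolding zombie_zone_def by auto
qed

text \<open>Inside gadget \<open>i\<close> the flood certificate applies. Elsewhere the distance to
  the hub drops every round, so the bound 7 persists and the hub is reached while the flood still
  contains 0.\<close>

lemma zombie_zone_step:
  assumes "i < k" "u \<in> zombie_zone i n"
    and mv: "zombie_move (gadget_star k) (copy i (survivor_walk n)) u w"
  shows "w \<in> zombie_zone i (Suc n)"
proof -
  note fl = floodsD[OF floods_all[of n]]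
  consider a where "a \<in> set (flood n)" "u = copy i a"
    | j a where "j \<noteq> i" "0 < a" "a < 24" "gadget_dist 0 a + n \<le> 7" "u = copy j a"
    using assms(2) by (auto simp: zombie_zone_def)
  then show ?thesis
  proof cases
    case (1 a)
    then obtain b where "(a, b) \<in> set gadget_arcs"
        "gadget_dist (survivor_walk n) b < gadget_dist (survivor_walk n) a" "w = copy i b"
      using zombie_move_gadget_star(1)[OF survivor_walk_less assms(1) fl(3)[OF 1(1)], of n i w] mv by auto
    then show ?thesis using fl(4)[OF 1(1)] by (auto simp: zombie_zone_def)
  next
    case (2 j a)
    then obtain b where b: "(a, b) \<in> set gadget_arcs" "gadget_dist 0 b < gadget_dist 0 a" "w = copy j b"
      using zombie_move_gadget_star(2)[OF survivor_walk_less assms(1) 2(3), of n j w] mv by auto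
    show ?thesis
    proof (cases "b = 0")
      case True
      have "Suc n < 8" using b(2) 2(4) by simp
      then have "Suc n \<in> set [0..<8]" by simp
      then have "0 \<in> set (flood (Suc n))"
        using hub_in_flood unfolding list_all_iff by blast
      moreover have "w = copy i 0" using True b(3) by (simp add: copy_def)
      ultimately show ?thesis by (simp add: zombie_zone_def)
    next
      case False
      then show ?thesis
        using b 2 gadget_arcsD(2)[OF b(1)] unfolding zombie_zone_def by force
    qed
  qed
qed

lemma survivor_not_in_zombie_zone:
  "copy i (survivor_walk n) \<notin> zombie_zone i n" "copy i (survivor_walk n) \<notin> zombie_zone i (Suc n)"
proof -
  have w: "survivor_walk n < 24" "survivor_walk n \<noteq> 0"
    using survivor_walk_less[of n] by (auto simp: survivor_walk_def)
  have "copy i (survivor_walk n) \<notin> zombie_zone i m" if "survivor_walk n \<notin> set (flood m)" for m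
    using that w floodsD(3)[OF floods_all[of m]] by (auto simp: zombie_zone_def copy_eq_iff)
  then show "copy i (survivor_walk n) \<notin> zombie_zone i n" "copy i (survivor_walk n) \<notin> zombie_zone i (Suc n)"
    using floodsD(1,2)[OF floods_all[of n]] by auto
qed

lemma survivor_walk_legal:
  assumes "i < k"
  shows "survivor_legal (gadget_star k) (\<lambda>n. copy i (survivor_walk n)) n"
proof (cases n)
  case 0
  then show ?thesis
    using assms survivor_walk_less[of 0] copy_le[of i k "survivor_walk 0"]
    by (simp add: survivor_legal_def gadget_star_def)
next
  case (Suc m)
  then show ?thesis
    using assms survivor_walk_arc[of m]
    by (auto simp: survivor_legal_def survivor_move_def gadget_star_def)
qed

text \<open>Pigeonhole on copy indices. Truncated subtraction gives the hub index 0, so a hub zombie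
  at worst rules out copy 0, and \<open>m < k\<close> still leaves a free index.\<close>

lemma zombie_free_gadget:
  assumes "placement (gadget_star k) m zs" "m < k"
  obtains i where "i < k" "set zs \<subseteq> zombie_zone i 0"
proof -
  have "card ((\<lambda>v. (v - 1) div 23) ` set zs) \<le> m"
    using assms(1) card_image_le[of "set zs" "\<lambda>v. (v - 1) div 23"] card_length[of zs]
    by (simp add: placement_def)
  then have "\<not> {..<k} \<subseteq> (\<lambda>v. (v - 1) div 23) ` set zs"
    using assms(2) card_mono[of "(\<lambda>v. (v - 1) div 23) ` set zs" "{..<k}"] by auto
  then obtain i where i: "i < k" "i \<notin> (\<lambda>v. (v - 1) div 23) ` set zs" by auto
  have "v \<in> zombie_zone i 0" if "v \<in> set zs" for v
    using that assms i by (intro zombie_zone_start[of v k]) (auto simp: placement_def gadget_star_def)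
  then show ?thesis using that i(1) by blast
qed

theorem theorem1:
  fixes k :: nat
  assumes "k \<ge> 2"
  shows "\<exists>G :: nat pair_pre_digraph.
    pair_graph G \<and> Digraph_Component.connected (with_proj G) \<and> outerplanar G \<and>
    card (pverts G) = 23 * k + 1 \<and>
    zombie_number G \<ge> k \<and>
    (\<forall>m zs. m \<le> k - 1 \<longrightarrow> placement G m zs \<longrightarrow> survivor_wins_from G zs)"
proof (intro exI conjI allI impI)
  let ?G = "gadget_star k"
  show "pair_graph ?G" by (rule pair_graph_gadget_star)
  show "Digraph_Component.connected (with_proj ?G)"
    using assms by (intro connected_gadget_star) simp
  show "outerplanar ?G"
    by (intro noncrossing_imp_outerplanar pair_graph_gadget_star gadget_star_noncrossing)
  show "card (pverts ?G) = 23 * k + 1" by (simp add: gadget_star_def)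
  show "survivor_wins_from ?G zs" if "m \<le> k - 1" "placement ?G m zs" for m zs
  proof -
    have "m < k" using that(1) assms by simp
    with that(2) obtain i where "i < k" "set zs \<subseteq> zombie_zone i 0"
      by (rule zombie_free_gadget)
    then show ?thesis
      using zombie_zone_step survivor_not_in_zombie_zone survivor_walk_legal
      by (intro survivor_wins_by_evasive_walk(1)[where I = "zombie_zone i" and S = "\<lambda>n. copy i (survivor_walk n)"])
  qed
  show "zombie_number ?G \<ge> k"
  proof (rule ccontr)
    assume "\<not> zombie_number ?G \<ge> k"
    then have less: "zombie_number ?G < k" by simp
    \<comment> \<open>Some number of zombies wins, namely one per vertex, so the least such number
      is itself winning.\<close>
    have "zombies_win ?G (zombie_number ?G)"
      unfolding zombie_number_def by (rule LeastI, rule zombies_win_card[OF pair_graph_gadget_star])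
    then obtain \<sigma> where pl: "placement ?G (zombie_number ?G) (\<sigma> [])"
      and win: "\<And>S. (\<forall>n. survivor_legal ?G S n) \<Longrightarrow>
        (\<forall>n. zombies_legal ?G (zombie_play \<sigma> S) S n) \<and> (\<exists>n. captured (zombie_play \<sigma> S) S n)"
      unfolding zombies_win_def by blast
    obtain i where i: "i < k" "set (\<sigma> []) \<subseteq> zombie_zone i 0"
      using zombie_free_gadget[OF pl less] .
    \<comment> \<open>The walk depends only on the starting placement \<open>\<sigma> []\<close>, so
      it can be fixed in advance and played against \<open>\<sigma>\<close>.\<close>
    let ?S = "\<lambda>n. copy i (survivor_walk n)"
    have "\<forall>n. survivor_legal ?G ?S n" using survivor_walk_legal[OF i(1)] by blast
    from win[OF this] obtain n where "\<And>n. zombies_legal ?G (zombie_play \<sigma> ?S) ?S n"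
      and "captured (zombie_play \<sigma> ?S) ?S n" by blast
    then show False
      using survivor_wins_by_evasive_walk(2)[of "\<sigma> []" "zombie_zone i" ?G ?S \<sigma> n]
        i zombie_zone_step survivor_not_in_zombie_zone survivor_walk_legal by blast
  qed
qed

end
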